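(* Fix integers $k \ge 2$ and $\ell \ge 1$. Then for every integer $n \ge \binom{k+\ell}{k-1} + \binom{k+\ell-1}{k-1}$ (with $r = n-\ell > k$), there is no primitive uniquely $K_{r}^{(k)}$-saturated $k$-uniform hypergraph on $n$ vertices, where $r = n - \ell$.
   Context: $K_r^{(k)}$ denotes the complete $k$-uniform hypergraph on $r$ vertices. A $k$-uniform hypergraph $H$ is uniquely $K_r^{(k)}$-saturated if $H$ contains no copy of $K_r^{(k)}$ (i.e., no $r$-set of vertices all of whose $k$-subsets are edges), and for every $k$-subset $S$ of $V(H)$ that is not an edge of $H$, the hypergraph $H+S$ contains exactly one copy of $K_r^{(k)}$. A vertex $v$ is dominating in $H$ if every $k$-subset of $V(H)$ containing $v$ is an edge of $H$. $H$ is primitive uniquely $K_r^{(k)}$-saturated if it is uniquely $K_r^{(k)}$-saturated and has no dominating vertex. *)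

theory Defs
  imports Main "HOL-Library.Ramsey"
begin

text \<open>
  A hypergraph is given by its vertex set \<open>V\<close> and its edge set \<open>E\<close>;
  \<open>nsets V k\<close> is the set of all \<open>k\<close>-element subsets of \<open>V\<close>.
\<close>

definition uniform_hypergraph :: "nat \<Rightarrow> 'a set \<Rightarrow> 'a set set \<Rightarrow> bool" where
  "uniform_hypergraph k V E \<longleftrightarrow> finite V \<and> E \<subseteq> nsets V k"

definition complete_copy :: "nat \<Rightarrow> nat \<Rightarrow> 'a set \<Rightarrow> 'a set set \<Rightarrow> 'a set \<Rightarrow> bool" where
  "complete_copy k r V E R \<longleftrightarrow> R \<in> nsets V r \<and> nsets R k \<subseteq> E"

definition uniquely_saturated :: "nat \<Rightarrow> nat \<Rightarrow> 'a set \<Rightarrow> 'a set set \<Rightarrow> bool" where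
  "uniquely_saturated k r V E \<longleftrightarrow>
     uniform_hypergraph k V E \<and>
     (\<nexists>R. complete_copy k r V E R) \<and>
     (\<forall>S \<in> nsets V k - E. \<exists>!R. complete_copy k r V (insert S E) R)"

definition dominating_vertex :: "nat \<Rightarrow> 'a set \<Rightarrow> 'a set set \<Rightarrow> 'a \<Rightarrow> bool" where
  "dominating_vertex k V E v \<longleftrightarrow> v \<in> V \<and> (\<forall>S \<in> nsets V k. v \<in> S \<longrightarrow> S \<in> E)"

definition primitive_uniquely_saturated :: "nat \<Rightarrow> nat \<Rightarrow> 'a set \<Rightarrow> 'a set set \<Rightarrow> bool" where
  "primitive_uniquely_saturated k r V E \<longleftrightarrow>
     uniquely_saturated k r V E \<and> (\<nexists>v. dominating_vertex k V E v)"

end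

theory Submission
  imports Defs "HOL-Computational_Algebra.Polynomial" "HOL-Library.Function_Algebras"
begin

text \<open>
  Let \<open>F\<close> be the family of non-edges. A set of \<open>r = n - l\<close> vertices spans a complete copy iff its
  complement meets every member of \<open>F\<close>; so no \<open>l\<close>-set meets all of \<open>F\<close>, for each \<open>S \<in> F\<close> some
  \<open>l\<close>-set meets all of \<open>F\<close> but \<open>S\<close>, and hence, without dominating vertices, every vertex lies in an
  \<open>(l + 1)\<close>-set \<open>B\<close> meeting all of \<open>F\<close>. Build \<open>V\<close> up as a union of such sets \<open>B\<close>. When \<open>B\<close> is
  added to the union \<open>R\<close> of the previous ones, each of its new vertices yields a pair \<open>(A, T)\<close> of
  disjoint sets, \<open>A\<close> being the trace on \<open>R\<close> of an edge and \<open>card T \<le> l\<close>, such that pairs with equal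
  \<open>card A\<close> are skew cross-intersecting. By the skew version of Bollobas's theorem at most
  \<open>(s + l) choose s\<close> pairs have \<open>card A = s\<close>; summing over \<open>1 \<le> s < k\<close> and adding the \<open>l + 1\<close>
  vertices of the first \<open>B\<close> gives \<open>n \<le> l + ((k + l) choose (k - 1))\<close>, which is below the
  assumed bound.
\<close>

section \<open>Linear algebra for real-valued functions\<close>

text \<open>Forms are handled as functions of the coefficient vector, so that independence can be
  tested by evaluating at points.\<close>

interpretation real_fun: vector_space "\<lambda>(r::real) (f::'b \<Rightarrow> real) x. r * f x"
  by unfold_locales (auto simp: fun_eq_iff algebra_simps)

text \<open>A multiset \<open>m\<close> encodes the monomial in which each variable
  \<open>c i\<close> has its multiplicity in \<open>m\<close> as exponent. Multiplying by
  \<open>c i\<close> adds \<open>i\<close> to \<open>m\<close>; the rest is linearity.\<close>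

lemma span_linear_form_mult:
  fixes f :: "(nat \<Rightarrow> real) \<Rightarrow> real"
  assumes "f \<in> real_fun.span ((\<lambda>m c. \<Prod>i\<in>#m. c i) ` multisets_of_size {..l} s)"
  shows "(\<lambda>c. (\<Sum>i\<le>l. y i * c i) * f c)
           \<in> real_fun.span ((\<lambda>m c. \<Prod>i\<in>#m. c i) ` multisets_of_size {..l} (Suc s))"
    (is "_ \<in> real_fun.span ?M'")
  using assms
proof (induction rule: real_fun.span_induct_alt)
  case base
  have "(\<lambda>c. (\<Sum>i\<le>l. y i * c i) * (0 :: (nat \<Rightarrow> real) \<Rightarrow> real) c) = 0"
    by (simp add: fun_eq_iff)
  then show ?case
    by (simp add: real_fun.span_zero)
next
  case (step r g h)
  then obtain m where m: "m \<in> multisets_of_size {..l} s" and g: "g = (\<lambda>c. \<Prod>i\<in>#m. c i)"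
    by auto
  have mono: "(\<lambda>c. c i * g c) \<in> real_fun.span ?M'" if "i \<le> l" for i
  proof (rule real_fun.span_base, rule image_eqI)
    show "add_mset i m \<in> multisets_of_size {..l} (Suc s)"
      using m that by (auto simp: multisets_of_size_def)
  qed (simp add: g)
  have "(\<Sum>i\<le>l. (\<lambda>c. (r * y i) * (c i * g c))) \<in> real_fun.span ?M'"
    by (intro real_fun.span_sum real_fun.span_scale mono) simp
  then have "(\<Sum>i\<le>l. (\<lambda>c. (r * y i) * (c i * g c))) + (\<lambda>c. (\<Sum>i\<le>l. y i * c i) * h c)
               \<in> real_fun.span ?M'"
    using step.IH by (rule real_fun.span_add)
  also have "(\<Sum>i\<le>l. (\<lambda>c. (r * y i) * (c i * g c))) + (\<lambda>c. (\<Sum>i\<le>l. y i * c i) * h c)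
               = (\<lambda>c. (\<Sum>i\<le>l. y i * c i) * ((\<lambda>x. r * g x) + h) c)"
  proof
    fix c
    have "(\<Sum>i\<le>l. (\<lambda>c. (r * y i) * (c i * g c))) c = (\<Sum>i\<le>l. (r * y i) * (c i * g c))"
      by (induction l) auto
    then show "((\<Sum>i\<le>l. (\<lambda>c. (r * y i) * (c i * g c))) + (\<lambda>c. (\<Sum>i\<le>l. y i * c i) * h c)) c
               = (\<Sum>i\<le>l. y i * c i) * ((\<lambda>x. r * g x) + h) c"
      by (simp add: algebra_simps sum_distrib_left sum_distrib_right)
  qed
  finally show ?case .
qed

lemma prod_linear_forms_in_span:
  fixes y :: "'a \<Rightarrow> nat \<Rightarrow> real"
  assumes "finite A"
  shows "(\<lambda>c. \<Prod>a\<in>A. \<Sum>i\<le>l. y a i * c i)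
           \<in> real_fun.span ((\<lambda>m c. \<Prod>i\<in>#m. c i) ` multisets_of_size {..l} (card A))"
  using assms
proof (induction A)
  case empty
  have "(\<lambda>c::nat \<Rightarrow> real. 1) \<in> (\<lambda>m c. \<Prod>i\<in>#m. c i) ` multisets_of_size {..l} 0"
    by (rule image_eqI[of _ _ "{#}"]) (auto simp: multisets_of_size_def)
  then show ?case
    by (simp add: real_fun.span_base)
next
  case (insert a A)
  then show ?case
    using span_linear_form_mult[OF insert.IH, of "y a"] by simp
qed

text \<open>Evaluation at the last point kills every earlier function, hence their span, but not the
  last function. So the last function lies outside that span, which also makes it distinct from the
  earlier ones.\<close>

lemma triangular_independent:
  fixes ps :: "(('b \<Rightarrow> real) \<times> 'b) list"
  assumes "sorted_wrt (\<lambda>p q. fst p (snd q) = 0) ps" "\<forall>(f, x)\<in>set ps. f x \<noteq> 0"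
  shows "real_fun.independent (fst ` set ps) \<and> card (fst ` set ps) = length ps"
  using assms
proof (induction ps rule: rev_induct)
  case Nil
  then show ?case
    by (simp add: real_fun.independent_empty)
next
  case (snoc p ps)
  obtain f x where p: "p = (f, x)"
    by (cases p)
  have IH: "real_fun.independent (fst ` set ps) \<and> card (fst ` set ps) = length ps"
    using snoc by (simp add: sorted_wrt_append)
  have zero: "g x = 0" if "g \<in> real_fun.span (fst ` set ps)" for g
    using that
  proof (induction rule: real_fun.span_induct_alt)
    case (step r g h)
    then show ?case
      using snoc.prems p by (auto simp: sorted_wrt_append)
  qed simp
  moreover have "f x \<noteq> 0"
    using snoc.prems p by auto
  ultimately have f: "f \<notin> real_fun.span (fst ` set ps)"
    by auto
  then have "f \<notin> fst ` set ps"
    using real_fun.span_base by blast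
  then show ?case
    using IH f p by (simp add: real_fun.independent_insertI)
qed

section \<open>Skew version of Bollobas's theorem\<close>

text \<open>Lovasz's polynomial argument: with the vertices placed at distinct reals \<open>v a\<close>, the pair
  \<open>(A, T)\<close> gives the form \<open>p \<mapsto> \<Prod>a\<in>A. p (v a)\<close> of degree \<open>s\<close> in the \<open>l + 1\<close> coefficients of \<open>p\<close>
  and the point \<open>p = \<Prod>t\<in>T. X - v t\<close>.\<close>

lemma skew_bollobas:
  fixes ps :: "('a set \<times> 'a set) list"
  assumes pairs: "\<And>A T. (A, T) \<in> set ps \<Longrightarrow> finite A \<and> card A = s \<and> finite T \<and> card T \<le> l \<and> A \<inter> T = {}"
    and skew: "sorted_wrt (\<lambda>p q. fst p \<inter> snd q \<noteq> {}) ps"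
  shows "length ps \<le> (s + l) choose s"
proof -
  define U where "U = (\<Union>(A, T)\<in>set ps. A \<union> T)"
  have "finite U"
    by (auto simp: U_def dest: pairs)
  from finite_imp_inj_to_nat_seg[OF this] obtain v' :: "'a \<Rightarrow> nat" where v': "inj_on v' U"
    by auto
  define v where "v a = real (v' a)" for a
  have v: "v a = v b \<longleftrightarrow> a = b" if "a \<in> U" "b \<in> U" for a b
    using v' that by (auto simp: v_def inj_on_def)
  define form where "form A = (\<lambda>c. \<Prod>a\<in>A. \<Sum>i\<le>l. v a ^ i * c i)" for A
  define pt where "pt T = (\<Prod>t\<in>T. [:- v t, 1:])" for T
  have eval: "form A (coeff (pt T)) = (\<Prod>a\<in>A. \<Prod>t\<in>T. v a - v t)" if "card T \<le> l" for A T
  proof -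
    \<comment> \<open>Thus the coefficients with index at most \<open>l\<close> determine
      \<open>pt T\<close>, and the inner sum of \<open>form\<close> is its value at
      \<open>v a\<close>.\<close>
    have "degree (pt T) \<le> l"
      using that by (simp add: pt_def degree_prod_sum_eq)
    then have "(\<Sum>i\<le>l. v a ^ i * coeff (pt T) i) = poly (pt T) (v a)" for a
      unfolding poly_altdef
      by (intro sum.mono_neutral_cong_right) (auto simp: coeff_eq_0)
    then show ?thesis
      by (simp add: form_def pt_def poly_prod algebra_simps)
  qed
  define qs where "qs = map (\<lambda>(A, T). (form A, coeff (pt T))) ps"
  have "sorted_wrt (\<lambda>p q. fst p (snd q) = 0) qs"
    unfolding qs_def sorted_wrt_map
  proof (rule sorted_wrt_mono_rel[OF _ skew], clarsimp)
    fix A T A' T'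
    assume *: "(A, T) \<in> set ps" "(A', T') \<in> set ps" "A \<inter> T' \<noteq> {}"
    then obtain a where "a \<in> A" "a \<in> T'"
      by auto
    then show "form A (coeff (pt T')) = 0"
      using pairs[OF *(1)] pairs[OF *(2)] by (subst eval) (auto intro!: bexI[of _ a])
  qed
  moreover have "\<forall>(f, c)\<in>set qs. f c \<noteq> 0"
  proof (clarsimp simp: qs_def)
    fix A T
    assume *: "(A, T) \<in> set ps" "form A (coeff (pt T)) = 0"
    then have "A \<subseteq> U" "T \<subseteq> U"
      by (auto simp: U_def)
    moreover obtain a t where "a \<in> A" "t \<in> T" "v a = v t"
      using pairs[OF *(1)] *(2) by (auto simp: eval)
    ultimately show False
      using pairs[OF *(1)] v by blast
  qed
  ultimately have ind: "real_fun.independent (fst ` set qs)" and card: "card (fst ` set qs) = length ps"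
    using triangular_independent[of qs] by (auto simp: qs_def)
  \<comment> \<open>The monomials of degree \<open>s\<close> in \<open>l + 1\<close> variables span
    all the forms, and there are at most \<open>(s + l) choose s\<close> of them.\<close>
  define M where "M = (\<lambda>m c. \<Prod>i\<in>#m. (c i :: real)) ` multisets_of_size {..l} s"
  have "form A \<in> real_fun.span M" if "(A, T) \<in> set ps" for A T
    using prod_linear_forms_in_span[of A "\<lambda>a i. v a ^ i" l] pairs[OF that]
    by (simp add: form_def M_def)
  then have "fst ` set qs \<subseteq> real_fun.span M"
    by (auto simp: qs_def)
  moreover have fin: "finite (multisets_of_size {..l} s)"
    by (intro finite_multisets_of_size) auto
  ultimately have "length ps \<le> card M"
    using real_fun.independent_span_bound[OF _ ind] card unfolding M_def by auto
  also have "\<dots> \<le> card (multisets_of_size {..l} s)"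
    unfolding M_def using fin by (rule card_image_le)
  also have "\<dots> = (s + l) choose s"
    by (subst card_multisets_of_size) (auto simp: add.commute)
  finally show ?thesis .
qed

lemma skew_bollobas_graded:
  fixes ps :: "('a set \<times> 'a set) list"
  assumes pairs: "\<And>A T. (A, T) \<in> set ps \<Longrightarrow>
      finite A \<and> 1 \<le> card A \<and> card A \<le> d \<and> finite T \<and> card T \<le> l \<and> A \<inter> T = {}"
    and skew: "sorted_wrt (\<lambda>p q. card (fst p) = card (fst q) \<longrightarrow> fst p \<inter> snd q \<noteq> {}) ps"
  shows "length ps < Suc (l + d) choose d"
proof -
  define level where "level s = filter (\<lambda>p. card (fst p) = s) ps" for s
  have "length (level s) \<le> (s + l) choose s" for s
  proof (rule skew_bollobas)
    show "sorted_wrt (\<lambda>p q. fst p \<inter> snd q \<noteq> {}) (level s)"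
      using sorted_wrt_filter[OF skew, of "\<lambda>p. card (fst p) = s"] unfolding level_def
      by (rule sorted_wrt_mono_rel[rotated]) auto
  next
    fix A T
    assume "(A, T) \<in> set (level s)"
    then show "finite A \<and> card A = s \<and> finite T \<and> card T \<le> l \<and> A \<inter> T = {}"
      using pairs[of A T] by (simp add: level_def)
  qed
  moreover have "length ps = (\<Sum>s=1..d. length (level s))"
  proof -
    have "\<forall>p\<in>set ps. card (fst p) \<in> {1..d}"
    proof
      fix p
      assume "p \<in> set ps"
      then show "card (fst p) \<in> {1..d}"
        using pairs[of "fst p" "snd p"] by simp
    qed
    then show ?thesis
      unfolding level_def
    proof (induction ps)
      case (Cons p ps)
      have "(\<Sum>s=1..d. length (filter (\<lambda>q. card (fst q) = s) (p # ps)))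
          = (\<Sum>s=1..d. (if card (fst p) = s then 1 else 0) + length (filter (\<lambda>q. card (fst q) = s) ps))"
        by (intro sum.cong) auto
      also have "\<dots> = 1 + length ps"
        using Cons by (simp add: sum.distrib)
      finally show ?case
        by simp
    qed simp
  qed
  ultimately have "length ps \<le> (\<Sum>s=1..d. (s + l) choose s)"
    by (simp add: sum_mono)
  \<comment> \<open>The inequality is strict because the right side has the extra term 1 at
    \<open>s = 0\<close>.\<close>
  also have "\<dots> < (\<Sum>s\<le>d. (l + s) choose s)"
    by (simp add: atMost_atLeast0 sum.atLeast_Suc_atMost add.commute)
  finally show ?thesis
    by (simp add: sum_choose_lower)
qed

section \<open>Building the vertex set from sets that meet every edge\<close>

definition crossing :: "'a set \<times> 'a set \<Rightarrow> 'a set \<times> 'a set \<Rightarrow> bool" where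
  "crossing p q \<longleftrightarrow> card (fst p) = card (fst q) \<longrightarrow> fst p \<inter> snd q \<noteq> {}"

text \<open>The last conjunct is the invariant that lets pairs found later cross this one: their
  first components are traces of edges on a set containing \<open>R\<close>. Enlarging
  \<open>R\<close> only enlarges the traces \<open>f \<inter> R\<close>, so it preserves the
  condition.\<close>

definition admissible :: "'a set set \<Rightarrow> 'a set \<Rightarrow> nat \<Rightarrow> nat \<Rightarrow> 'a set \<times> 'a set \<Rightarrow> bool" where
  "admissible F R d l p \<longleftrightarrow>
     finite (fst p) \<and> 1 \<le> card (fst p) \<and> card (fst p) \<le> d \<and>
     finite (snd p) \<and> card (snd p) \<le> l \<and> snd p \<subseteq> R \<and> fst p \<inter> snd p = {} \<and>
     (\<forall>f\<in>F. card (f \<inter> R) \<le> card (fst p) \<longrightarrow> f \<inter> snd p \<noteq> {})"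

lemma admissible_superset:
  assumes "admissible F R' d l p" "R' \<subseteq> R" "\<forall>f\<in>F. finite f"
  shows "admissible F R d l p"
proof -
  have "card (f \<inter> R') \<le> card (f \<inter> R)" if "f \<in> F" for f
    using assms that by (intro card_mono) auto
  then show ?thesis
    using assms unfolding admissible_def by (meson order_trans)
qed

text \<open>Greedy step: \<open>T\<close> consists of \<open>B \<inter> R\<close> and one vertex of each earlier trace, and \<open>A\<close> is a
  smallest trace on \<open>R\<close> of an edge missed by \<open>T\<close>. An edge missed by \<open>T\<close> meets \<open>B - R\<close>, so its
  trace on \<open>R \<union> B\<close> is larger than its trace on \<open>R\<close>, hence larger than \<open>A\<close>.\<close>

lemma pairs_for_new_vertices:
  assumes edges: "\<forall>f\<in>F. finite f \<and> card f \<le> Suc d"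
    and unhit: "\<And>W. finite W \<Longrightarrow> card W \<le> l \<Longrightarrow> \<exists>f\<in>F. f \<inter> W = {}"
    and B: "finite B" "card B \<le> Suc l" "\<forall>f\<in>F. f \<inter> B \<noteq> {}"
    and R: "\<forall>f\<in>F. f \<inter> R \<noteq> {}"
    and "i \<le> card (B - R)"
  shows "\<exists>ps X. length ps = i \<and> finite X \<and> card X \<le> i \<and> X \<subseteq> R \<and>
           (\<forall>p\<in>set ps. fst p \<inter> X \<noteq> {} \<and> (\<exists>f\<in>F. fst p = f \<inter> R) \<and> admissible F (B \<union> R) d l p) \<and>
           sorted_wrt crossing ps"
  using \<open>i \<le> card (B - R)\<close>
proof (induction i)
  case 0
  show ?case
    by (intro exI[of _ "[]"] exI[of _ "{}"]) simp
next
  case (Suc i)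
  from Suc.IH[OF Suc_leD[OF Suc.prems]]
  obtain ps X where len: "length ps = i" and X: "finite X" "card X \<le> i" "X \<subseteq> R"
    and ps: "\<forall>p\<in>set ps. fst p \<inter> X \<noteq> {} \<and> (\<exists>f\<in>F. fst p = f \<inter> R) \<and> admissible F (B \<union> R) d l p"
    and sorted: "sorted_wrt crossing ps"
    by blast
  define T where "T = (B \<inter> R) \<union> X"
  have "card (B \<inter> R) + card (B - R) = card B"
    using B by (subst card_Un_disjoint[symmetric]) (auto intro: arg_cong[where f = card])
  \<comment> \<open>Since \<open>B - R\<close> has at least \<open>Suc i\<close> vertices,
    \<open>B \<inter> R\<close> has at most \<open>l - i\<close>, which leaves room for the at most
    \<open>i\<close> vertices of \<open>X\<close>.\<close>
  then have "card T \<le> l"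
    using card_Un_le[of "B \<inter> R" X] X B Suc.prems unfolding T_def by linarith
  have T: "finite T" "T \<subseteq> R"
    using X B by (auto simp: T_def)
  from unhit[OF T(1) \<open>card T \<le> l\<close>] obtain f0 where "f0 \<in> F \<and> f0 \<inter> T = {}"
    by blast
  from ex_has_least_nat[of "\<lambda>f. f \<in> F \<and> f \<inter> T = {}", OF this, of "\<lambda>f. card (f \<inter> R)"]
  obtain f where f: "f \<in> F" "f \<inter> T = {}"
    and min: "\<And>h. h \<in> F \<Longrightarrow> h \<inter> T = {} \<Longrightarrow> card (f \<inter> R) \<le> card (h \<inter> R)"
    by blast
  have new_vertex: "\<exists>b\<in>h \<inter> B. b \<notin> R" if "h \<in> F" "h \<inter> T = {}" for h
    using B that by (auto simp: T_def)
  have "f \<inter> R \<subset> f"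
    using new_vertex[OF f] by auto
  then have "card (f \<inter> R) < card f"
    using edges f by (intro psubset_card_mono) auto
  then have card: "card (f \<inter> R) \<le> d"
    using edges f by fastforce
  have "h \<inter> T \<noteq> {}" if "h \<in> F" "card (h \<inter> (B \<union> R)) \<le> card (f \<inter> R)" for h
  proof
    assume hT: "h \<inter> T = {}"
    then have "h \<inter> R \<subset> h \<inter> (B \<union> R)"
      using new_vertex[OF \<open>h \<in> F\<close>] by auto
    then have "card (h \<inter> R) < card (h \<inter> (B \<union> R))"
      using edges \<open>h \<in> F\<close> by (intro psubset_card_mono) auto
    then show False
      using min[OF \<open>h \<in> F\<close> hT] that by simp
  qed
  moreover have nonempty: "f \<inter> R \<noteq> {}" and "finite (f \<inter> R)"
    using R edges f by auto
  then have "1 \<le> card (f \<inter> R)"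
    by (simp add: Suc_le_eq card_gt_0_iff)
  ultimately have adm: "admissible F (B \<union> R) d l (f \<inter> R, T)"
    using T f card \<open>card T \<le> l\<close> \<open>finite (f \<inter> R)\<close> unfolding admissible_def by auto
  obtain w where w: "w \<in> f \<inter> R"
    using nonempty by auto
  let ?ps = "ps @ [(f \<inter> R, T)]" and ?X = "insert w X"
  have "sorted_wrt crossing ?ps"
    using sorted ps by (auto simp: sorted_wrt_append crossing_def T_def)
  moreover have "\<forall>p\<in>set ?ps. fst p \<inter> ?X \<noteq> {} \<and> (\<exists>f\<in>F. fst p = f \<inter> R) \<and> admissible F (B \<union> R) d l p"
    using ps adm w f(1) by auto
  moreover have "length ?ps = Suc i" "finite ?X" "card ?X \<le> Suc i" "?X \<subseteq> R"
    using len X w by (auto simp: card_insert_if)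
  ultimately show ?case
    by (intro exI[of _ ?ps] exI[of _ ?X]) simp
qed

text \<open>New pairs are put in front of the old ones. If the trace \<open>f \<inter> R\<close> of
  a new pair is as large as the first component of an old pair \<open>q\<close>, admissibility of
  \<open>q\<close> makes \<open>f\<close> meet \<open>snd q\<close>; as
  \<open>snd q \<subseteq> R\<close>, the trace itself meets \<open>snd q\<close>.\<close>

lemma pairs_for_union:
  assumes edges: "\<forall>f\<in>F. finite f \<and> card f \<le> Suc d"
    and unhit: "\<And>W. finite W \<Longrightarrow> card W \<le> l \<Longrightarrow> \<exists>f\<in>F. f \<inter> W = {}"
    and "Bs \<noteq> []" "\<forall>B\<in>set Bs. finite B \<and> card B \<le> Suc l \<and> (\<forall>f\<in>F. f \<inter> B \<noteq> {})"
  shows "\<exists>ps. card (\<Union>(set Bs)) \<le> length ps + Suc l \<and>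
           (\<forall>p\<in>set ps. admissible F (\<Union>(set Bs)) d l p) \<and> sorted_wrt crossing ps"
  using assms(3,4)
proof (induction Bs rule: list_nonempty_induct)
  case (single B)
  then show ?case
    by (intro exI[of _ "[]"]) auto
next
  case (cons B Bs)
  define R where "R = \<Union>(set Bs)"
  obtain qs where qs: "card R \<le> length qs + Suc l" "\<forall>p\<in>set qs. admissible F R d l p"
      "sorted_wrt crossing qs"
    using cons by (auto simp: R_def)
  have R: "\<forall>f\<in>F. f \<inter> R \<noteq> {}"
    using cons.hyps cons.prems by (cases Bs) (auto simp: R_def)
  have B: "finite B" "card B \<le> Suc l" "\<forall>f\<in>F. f \<inter> B \<noteq> {}"
    using cons.prems by auto
  obtain ps where ps: "length ps = card (B - R)" "sorted_wrt crossing ps"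
      "\<forall>p\<in>set ps. (\<exists>f\<in>F. fst p = f \<inter> R) \<and> admissible F (B \<union> R) d l p"
    using pairs_for_new_vertices[OF edges unhit B R order_refl] by blast
  have "crossing p q" if p: "p \<in> set ps" and q: "q \<in> set qs" for p q
  proof -
    obtain f where "f \<in> F" "fst p = f \<inter> R"
      using ps p by blast
    moreover have "admissible F R d l q"
      using qs q by blast
    ultimately show ?thesis
      unfolding crossing_def admissible_def by (metis Int_assoc inf.absorb_iff2 order_refl)
  qed
  then have "sorted_wrt crossing (ps @ qs)"
    using ps qs by (simp add: sorted_wrt_append)
  moreover have "admissible F (B \<union> R) d l q" if "q \<in> set qs" for q
    using admissible_superset[of F R d l q "B \<union> R"] qs edges that by blast
  then have "\<forall>p\<in>set (ps @ qs). admissible F (B \<union> R) d l p"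
    using ps by auto
  moreover have "card (B \<union> R) \<le> card (B - R) + card R"
    using card_Un_le[of "B - R" R] by simp
  then have "card (B \<union> R) \<le> length (ps @ qs) + Suc l"
    using ps qs by simp
  moreover have "\<Union>(set (B # Bs)) = B \<union> R"
    by (simp add: R_def)
  ultimately show ?case
    by metis
qed

lemma order_bound:
  assumes edges: "\<forall>f\<in>F. finite f \<and> card f \<le> Suc d"
    and unhit: "\<And>W. finite W \<Longrightarrow> card W \<le> l \<Longrightarrow> \<exists>f\<in>F. f \<inter> W = {}"
    and "finite V" "V \<noteq> {}"
    and cover: "\<And>v. v \<in> V \<Longrightarrow> \<exists>B. v \<in> B \<and> finite B \<and> card B \<le> Suc l \<and> (\<forall>f\<in>F. f \<inter> B \<noteq> {})"
  shows "card V \<le> l + (Suc (l + d) choose d)"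
proof -
  obtain B where B: "\<And>v. v \<in> V \<Longrightarrow> v \<in> B v \<and> finite (B v) \<and> card (B v) \<le> Suc l \<and> (\<forall>f\<in>F. f \<inter> B v \<noteq> {})"
    using cover by metis
  obtain vs where vs: "set vs = V"
    using \<open>finite V\<close> finite_list by blast
  let ?Bs = "map B vs"
  have "?Bs \<noteq> []" "\<forall>B\<in>set ?Bs. finite B \<and> card B \<le> Suc l \<and> (\<forall>f\<in>F. f \<inter> B \<noteq> {})"
    using vs \<open>V \<noteq> {}\<close> B by auto
  from pairs_for_union[OF edges unhit this] obtain ps
    where ps: "card (\<Union>(set ?Bs)) \<le> length ps + Suc l"
      "\<forall>p\<in>set ps. admissible F (\<Union>(set ?Bs)) d l p" "sorted_wrt crossing ps"
    by blast
  have "length ps < Suc (l + d) choose d"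
  proof (rule skew_bollobas_graded)
    fix A T
    assume "(A, T) \<in> set ps"
    then have "admissible F (\<Union>(set ?Bs)) d l (A, T)"
      using ps by blast
    then show "finite A \<and> 1 \<le> card A \<and> card A \<le> d \<and> finite T \<and> card T \<le> l \<and> A \<inter> T = {}"
      by (simp add: admissible_def)
  next
    show "sorted_wrt (\<lambda>p q. card (fst p) = card (fst q) \<longrightarrow> fst p \<inter> snd q \<noteq> {}) ps"
      using ps(3) by (simp add: crossing_def[abs_def])
  qed
  moreover have "card V \<le> card (\<Union>(set ?Bs))"
    using vs B by (intro card_mono) auto
  ultimately show ?thesis
    using ps(1) by linarith
qed

section \<open>Application to saturated hypergraphs\<close>

text \<open>With \<open>j = k - 2\<close> this shows that the second binomial coefficient of the
  assumed bound on \<open>n\<close> exceeds the summand \<open>l\<close> of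
  \<open>order_bound\<close>.\<close>

lemma less_choose_add: "l < (l + Suc j) choose Suc j"
  by (induction j) auto

theorem theorem5:
  fixes k l n r :: nat
  assumes "k \<ge> 2" and "l \<ge> 1"
    and "n \<ge> ((k + l) choose (k - 1)) + ((k + l - 1) choose (k - 1))"
    and "r = n - l" and "r > k"
  shows "\<not> (\<exists>(V :: 'a set) (E :: 'a set set).
           card V = n \<and> primitive_uniquely_saturated k r V E)"
proof
  assume "\<exists>(V :: 'a set) (E :: 'a set set). card V = n \<and> primitive_uniquely_saturated k r V E"
  then obtain V :: "'a set" and E where "card V = n" and prim: "primitive_uniquely_saturated k r V E"
    by blast
  then have "finite V" and no_copy: "\<And>R. \<not> complete_copy k r V E R"
    and copy: "\<And>S. S \<in> nsets V k - E \<Longrightarrow> \<exists>R. complete_copy k r V (insert S E) R"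
    and no_dom: "\<And>v. \<not> dominating_vertex k V E v"
    by (auto simp: primitive_uniquely_saturated_def uniquely_saturated_def uniform_hypergraph_def)
  define F where "F = nsets V k - E"
  have "n = r + l"
    using assms by linarith
  have "card V \<le> l + (Suc (l + (k - 1)) choose (k - 1))"
  proof (rule order_bound)
    show "\<forall>f\<in>F. finite f \<and> card f \<le> Suc (k - 1)"
      by (auto simp: F_def nsets_def)
    show "\<exists>f\<in>F. f \<inter> W = {}" if W: "finite W" "card W \<le> l" for W
    proof -
      have "r \<le> card (V - W)"
        using that \<open>n = r + l\<close> \<open>card V = n\<close> diff_card_le_card_Diff[of W V] by linarith
      then obtain R where R: "R \<subseteq> V - W" "card R = r" "finite R"
        using obtain_subset_with_card_n by metis
      then have "R \<in> nsets V r"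
        by (auto simp: nsets_def)
      then obtain f where "f \<in> nsets R k" "f \<notin> E"
        using no_copy[of R] by (auto simp: complete_copy_def)
      then have "f \<in> F" "f \<inter> W = {}"
        using R by (auto simp: F_def nsets_def)
      then show ?thesis
        by blast
    qed
    show "\<exists>B. v \<in> B \<and> finite B \<and> card B \<le> Suc l \<and> (\<forall>f\<in>F. f \<inter> B \<noteq> {})" if v: "v \<in> V" for v
    proof -
      \<comment> \<open>A non-edge \<open>S\<close> through \<open>v\<close> is the only one that
        can lie inside the copy \<open>R\<close> created by adding it. So the \<open>l\<close>
        vertices outside \<open>R\<close> meet all other non-edges, and \<open>v\<close> takes care
        of \<open>S\<close>.\<close>
      obtain S where S: "S \<in> F" "v \<in> S"
        using no_dom[of v] v by (auto simp: dominating_vertex_def F_def)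
      then obtain R where R: "R \<subseteq> V" "card R = r" and cliq: "nsets R k \<subseteq> insert S E"
        using copy[of S] by (auto simp: F_def complete_copy_def nsets_def)
      have "card (V - R) = l"
        using R \<open>finite V\<close> \<open>card V = n\<close> \<open>n = r + l\<close> by (simp add: card_Diff_subset finite_subset)
      then have "card (insert v (V - R)) \<le> Suc l"
        by (simp add: card_insert_if \<open>finite V\<close>)
      moreover have "f \<inter> insert v (V - R) \<noteq> {}" if "f \<in> F" for f
      proof
        assume disj: "f \<inter> insert v (V - R) = {}"
        then have "f \<in> nsets R k"
          using that by (auto simp: F_def nsets_def)
        then have "f = S"
          using cliq that by (auto simp: F_def)
        then show False
          using S disj by blast
      qed
      ultimately show ?thesis
        using \<open>finite V\<close> by (intro exI[of _ "insert v (V - R)"]) auto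
    qed
    show "finite V" "V \<noteq> {}"
      using \<open>finite V\<close> \<open>card V = n\<close> assms by auto
  qed
  moreover have "l < (k + l - 1) choose (k - 1)"
    using less_choose_add[of l "k - 2"] \<open>k \<ge> 2\<close>
    by (simp del: binomial_Suc_Suc add: Suc_diff_Suc numeral_2_eq_2 add.commute)
  moreover have "Suc (l + (k - 1)) = k + l"
    using \<open>k \<ge> 2\<close> by simp
  ultimately show False
    using assms(3) \<open>card V = n\<close> by (simp add: add.commute)
qed

end
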